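(* Let $H$ be a full directed graph and $X\subseteq\mathrm{Routes}(H)$ be a collection of cycles and good routes of $H$. Then there exists a cyclic ample framing $\kappa$ of $H$ such that $X$ equals the set of exceptional routes of $(H,\kappa)$ if and only if (i) $\mathrm{Cycles}(H)\subseteq X\subseteq\mathrm{Routes}(H)$, (ii) every edge of $H$ is contained in exactly one route of $X$, and (iii) the adjacency graph $\mathrm{Adj}(H,X)$ is bipartite.
   Context: $H=(V,E)$ is a connected directed graph (possibly with directed cycles) with no idle edges, sources and sinks of degree one, and full: every internal vertex has exactly two incoming and two outgoing edges. $\mathrm{Cycles}(H)$ is the set of minimal directed cycles; a good route is a walk from a source to a sink containing no minimal cycle; $\mathrm{Routes}(H)$ is the set of minimal cycles and good routes. A cyclic ample framing is a bi-colouring $\kappa:E\to\{\text{red},\text{blue}\}$ such that each internal vertex has one red and one blue incoming edge and one red and one blue outgoing edge, and every minimal directed cycle is monochromatic. Two source-to-sink routes $\rho=PSQ$, $\rho'=P'SQ'$ with common subwalk $S$ are incompatible if the last edge of $P$ and first edge of $Q'$ are blue and the first edge of $Q$ and last edge of $P'$ are red (or vice versa); a route compatible with every route is exceptional. $\mathrm{Adj}(H,X)$ is the graph with vertex set $X$ and an edge between any two distinct routes of $X$ passing through a common internal vertex. *)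

theory Defs
  imports "Graph_Theory.Graph_Theory" "HOL-Library.Sublist"
begin

datatype colour = Red | Blue

text \<open>
  A walk is a list of arcs. A cycle has no distinguished base point, so a cycle is the
  set of all closed walks obtained from one of them by rotation.
\<close>

datatype 'b route = Walk "'b awalk" | Cyc "'b awalk set"

fun route_arcs :: "'b route \<Rightarrow> 'b set" where
  "route_arcs (Walk p) = set p"
| "route_arcs (Cyc C) = (\<Union>c\<in>C. set c)"

definition cyc :: "'b awalk \<Rightarrow> 'b route" where
  "cyc c = Cyc {rotate n c | n. True}"

definition bipartite :: "('a, 'b) pre_digraph \<Rightarrow> bool" where
  "bipartite G \<longleftrightarrow> (\<exists>A B. verts G = A \<union> B \<and> A \<inter> B = {} \<and>
     (\<forall>e\<in>arcs G. tail G e \<in> A \<and> head G e \<in> B \<or> tail G e \<in> B \<and> head G e \<in> A))"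

context wf_digraph
begin

definition source :: "'a \<Rightarrow> bool" where
  "source v \<longleftrightarrow> v \<in> verts G \<and> in_degree G v = 0"

definition sink :: "'a \<Rightarrow> bool" where
  "sink v \<longleftrightarrow> v \<in> verts G \<and> out_degree G v = 0"

definition internal :: "'a \<Rightarrow> bool" where
  "internal v \<longleftrightarrow> v \<in> verts G \<and> \<not> source v \<and> \<not> sink v"

definition idle :: "'b \<Rightarrow> bool" where
  "idle e \<longleftrightarrow> e \<in> arcs G \<and>
     (internal (tail G e) \<and> out_arcs G (tail G e) = {e} \<or>
      internal (head G e) \<and> in_arcs G (head G e) = {e})"

definition minimal_cycle :: "'b awalk \<Rightarrow> bool" where
  "minimal_cycle c \<longleftrightarrow> closed_w c \<and> (\<forall>d. closed_w d \<and> sublist d c \<longrightarrow> d = c)"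

definition good_walk :: "'b awalk \<Rightarrow> bool" where
  "good_walk p \<longleftrightarrow> (\<exists>s t. source s \<and> sink t \<and> awalk s p t) \<and>
     \<not> (\<exists>c. minimal_cycle c \<and> sublist c p)"

definition Cycles :: "'b route set" where
  "Cycles = {cyc c | c. minimal_cycle c}"

definition good_routes :: "'b route set" where
  "good_routes = {Walk p | p. good_walk p}"

definition Routes :: "'b route set" where
  "Routes = Cycles \<union> good_routes"

definition route_verts :: "'b route \<Rightarrow> 'a set" where
  "route_verts \<rho> = tail G ` route_arcs \<rho> \<union> head G ` route_arcs \<rho>"

definition cyclic_ample_framing :: "('b \<Rightarrow> colour) \<Rightarrow> bool" where
  "cyclic_ample_framing \<kappa> \<longleftrightarrow>
     (\<forall>v k. internal v \<longrightarrow>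
        (\<exists>!e. e \<in> in_arcs G v \<and> \<kappa> e = k) \<and> (\<exists>!e. e \<in> out_arcs G v \<and> \<kappa> e = k)) \<and>
     (\<forall>c. minimal_cycle c \<longrightarrow> (\<exists>k. \<forall>e\<in>set c. \<kappa> e = k))"

text \<open>
  The common subwalk \<open>S\<close> may be a single vertex, that is, \<open>S = []\<close>. The equation between
  the heads says that \<open>S\<close> starts at the same vertex in both routes; it only
  matters if \<open>S = []\<close>. Incompatibility is about pairs of source-to-sink routes, so
  cycles are compatible with all routes.
\<close>

definition incompatible :: "('b \<Rightarrow> colour) \<Rightarrow> 'b route \<Rightarrow> 'b route \<Rightarrow> bool" where
  "incompatible \<kappa> \<rho> \<rho>' \<longleftrightarrow>
     (\<exists>P S Q P' Q' a b.
        \<rho> = Walk (P @ S @ Q) \<and> \<rho>' = Walk (P' @ S @ Q') \<and>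
        P \<noteq> [] \<and> Q \<noteq> [] \<and> P' \<noteq> [] \<and> Q' \<noteq> [] \<and>
        head G (last P) = head G (last P') \<and>
        a \<noteq> b \<and>
        \<kappa> (last P) = a \<and> \<kappa> (hd Q') = a \<and> \<kappa> (hd Q) = b \<and> \<kappa> (last P') = b)"

definition exceptional_routes :: "('b \<Rightarrow> colour) \<Rightarrow> 'b route set" where
  "exceptional_routes \<kappa> = {\<rho> \<in> Routes. \<forall>\<rho>'\<in>Routes. \<not> incompatible \<kappa> \<rho> \<rho>'}"

definition Adj :: "'b route set \<Rightarrow> ('b route, 'b route \<times> 'b route) pre_digraph" where
  "Adj X = \<lparr>verts = X,
     arcs = {(\<rho>, \<rho>'). \<rho> \<in> X \<and> \<rho>' \<in> X \<and> \<rho> \<noteq> \<rho>' \<and>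
              (\<exists>v. internal v \<and> v \<in> route_verts \<rho> \<and> v \<in> route_verts \<rho>')},
     tail = fst, head = snd\<rparr>"

end

text \<open>Loops, parallel arcs and directed cycles are allowed.\<close>

locale full_digraph = fin_digraph +
  assumes connected: "connected G"
    and no_idle: "\<not> (\<exists>e. idle e)"
    and degree_source: "source v \<Longrightarrow> out_degree G v = 1"
    and degree_sink: "sink v \<Longrightarrow> in_degree G v = 1"
    and full: "internal v \<Longrightarrow> in_degree G v = 2 \<and> out_degree G v = 2"

text \<open>The minimal cycles are the cycles of the graph library.\<close>

lemma (in wf_digraph) minimal_cycle_iff_cycle: "minimal_cycle c \<longleftrightarrow> cycle c"
proof
  assume m: "minimal_cycle c"
  then obtain u where u: "awalk u c u" and ne: "c \<noteq> []"
    by (auto simp: minimal_cycle_def closed_w_def)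
  from u have cas: "cas u c u" by auto
  have "distinct (map (head G) c)"
  proof (rule ccontr)
    assume "\<not> distinct (map (head G) c)"
    then obtain xs ys zs y where *: "map (head G) c = xs @ [y] @ ys @ [y] @ zs"
      using not_distinct_decomp by blast
    then obtain as a bs b cs where c: "c = as @ [a] @ bs @ [b] @ cs"
      and h: "head G a = y" "head G b = y"
      by (auto simp: map_eq_append_conv map_eq_Cons_conv append_eq_map_conv Cons_eq_map_conv)
    have c': "c = (as @ [a]) @ (bs @ [b]) @ cs" using c by simp
    have "awalk (head G a) (bs @ [b]) (head G b)"
      using u unfolding c by (auto simp: awalk_simps awalk_append_iff)
    then have "closed_w (bs @ [b])" using h by (auto simp: closed_w_def)
    moreover have "sublist (bs @ [b]) c" unfolding c' by (rule sublist_appendI)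
    ultimately have "bs @ [b] = c" using m by (auto simp: minimal_cycle_def)
    then show False using c by (auto dest: arg_cong[where f = length])
  qed
  then show "cycle c"
    using u ne awalk_verts_conv'[OF cas] by (auto simp: cycle_def)
next
  assume "cycle c"
  then obtain u where u: "awalk u c u" and ne: "c \<noteq> []"
    and d: "distinct (tl (awalk_verts u c))" by (auto simp: cycle_def)
  from u have cas: "cas u c u" by auto
  have d: "distinct (map (head G) c)" using d ne awalk_verts_conv'[OF cas] by simp
  have "e = c" if e: "closed_w e" "sublist e c" for e
  proof -
    from e obtain xs ys where c: "c = xs @ e @ ys" by (auto simp: sublist_def)
    from e obtain v where v: "awalk v e v" "e \<noteq> []" by (auto simp: closed_w_def)
    have last_head: "head G (last p) = w" if "awalk x p w" "p \<noteq> []" for x p w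
      using awlast_of_awalk[OF that(1)] that awalk_verts_conv[of x p] by auto
    have tail_hd: "tail G (hd p) = x" if "awalk x p w" "p \<noteq> []" for x p w
      using that by (cases p) (auto simp: awalk_simps)
    from u c obtain x y where w: "awalk u xs x" "awalk x e y" "awalk y ys u"
      by (auto simp: awalk_append_iff)
    have xy: "x = v" "y = v" using w v tail_hd last_head by metis+
    have le: "head G (last e) \<in> head G ` set e" using v by simp
    have "xs = []"
    proof (rule ccontr)
      assume "xs \<noteq> []"
      then have "head G (last xs) \<in> head G ` set xs" by simp
      moreover have "head G (last xs) = head G (last e)"
        using last_head[OF w(1) \<open>xs \<noteq> []\<close>] last_head[OF v] xy by simp
      ultimately show False using d le unfolding c by auto
    qed
    moreover have "ys = []"
    proof (rule ccontr)
      assume "ys \<noteq> []"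
      then have "head G (last ys) \<in> head G ` set ys" by simp
      moreover have "head G (last ys) = head G (last e)"
        using last_head[OF w(3) \<open>ys \<noteq> []\<close>] last_head[OF v] xy w(1) \<open>xs = []\<close>
        by (simp add: awalk_simps)
      ultimately show False using d le unfolding c by auto
    qed
    ultimately show ?thesis using c by simp
  qed
  then show "minimal_cycle c"
    using u ne by (auto simp: minimal_cycle_def closed_w_def)
qed

end

theory Submission
  imports Defs
begin

text \<open>
  For a cyclic ample framing the exceptional routes are the monochromatic ones, and following
  the unique continuation in the same colour partitions the arcs into monochromatic routes.
  Two of these with the same colour never share an internal vertex.

  The hard point is that a good route that switches from \<open>e\<close> to \<open>f\<close> at a vertex \<open>v\<close> is
  incompatible with a good route through the other two arcs \<open>e'\<close> and \<open>f'\<close> at \<open>v\<close>. If no sink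
  can be reached from \<open>f'\<close> without returning to \<open>v\<close>, then the set \<open>D\<close> of vertices reached
  in this way is internal, so as many arcs leave \<open>D\<close> as enter it. The arcs that leave \<open>D\<close> end
  in \<open>v\<close>, and \<open>e'\<close> is not one of them because a minimal cycle through \<open>e'\<close> and \<open>f'\<close> would have
  two colours. So \<open>f'\<close> is the only arc into \<open>D\<close> and \<open>e\<close> the only arc out of it, and the given
  route passes through \<open>v\<close> twice. Sources are treated dually, and the two halves are disjoint
  because an intersection would again yield a two-coloured minimal cycle.
\<close>

section \<open>Walks and minimal cycles\<close>

text \<open>Supplies the two consecutive arcs at which a walk with both colours switches.\<close>

lemma not_constant_split:
  assumes "\<not> (\<exists>k. \<forall>e\<in>set p. f e = k)"
  shows "\<exists>xs a b ys. p = xs @ a # b # ys \<and> f a \<noteq> f b"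
  using assms
proof (induction p)
  case (Cons a p)
  show ?case
  proof (cases "\<exists>k. \<forall>e\<in>set p. f e = k")
    case True
    then obtain b ys where p: "p = b # ys" using Cons.prems by (cases p) auto
    with True Cons.prems have "f a \<noteq> f b" by auto
    with p show ?thesis by (metis append_Nil)
  next
    case False
    then show ?thesis using Cons.IH by (metis append_Cons)
  qed
qed simp

text \<open>A right-unique relation leaves no choice after the common first entry, so the two chains
  can differ only in length.\<close>

lemma successively_prefix_cases:
  assumes "\<And>a b c. R a b \<Longrightarrow> R a c \<Longrightarrow> b = c"
    and "successively R (e # xs)" "successively R (e # ys)"
  shows "prefix xs ys \<or> prefix ys xs"
  using assms(2,3)
proof (induction xs arbitrary: e ys)
  case (Cons x xs)
  show ?case
  proof (cases ys)
    case (Cons y ys')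
    then have "x = y" using Cons.prems Cons.prems assms(1) by auto
    then show ?thesis using Cons Cons.prems Cons.IH[of x ys'] by auto
  qed simp
qed simp

definition monochromatic :: "('b \<Rightarrow> colour) \<Rightarrow> 'b set \<Rightarrow> bool" where
  "monochromatic \<kappa> A \<longleftrightarrow> (\<exists>k. \<forall>e\<in>A. \<kappa> e = k)"

lemma colour_eq: "(k::colour) \<noteq> j \<Longrightarrow> l \<noteq> j \<Longrightarrow> k = l"
  by (cases k; cases j; cases l) auto

context wf_digraph
begin

lemma awalk_append: "awalk u (p @ q) v \<longleftrightarrow> (\<exists>w. awalk u p w \<and> awalk w q v)"
  by auto

text \<open>Comparing this reading of the vertex list with the one through tails in
  \<open>awalk_verts_tails\<close> converts facts about heads into facts about tails.\<close>

lemma awalk_verts_heads: "awalk u p v \<Longrightarrow> awalk_verts u p = u # map (head G) p"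
  using awalk_verts_conv'[of u p v] by (cases p) (auto simp: awalk_simps)

lemma awalk_verts_tails: "awalk u p v \<Longrightarrow> awalk_verts u p = map (tail G) p @ [v]"
  by (induction p arbitrary: u) (auto simp: awalk_simps)

lemma minimal_cycle_iff_distinct_heads:
  "minimal_cycle c \<longleftrightarrow> closed_w c \<and> distinct (map (head G) c)"
  unfolding minimal_cycle_iff_cycle cycle_def closed_w_def
  by (metis awalk_verts_heads list.sel(3) length_greater_0_conv)

lemma minimal_cycle_rotate:
  assumes "minimal_cycle c"
  shows "minimal_cycle (rotate n c)"
proof (induction n)
  case (Suc n)
  then obtain u where u: "awalk u (rotate n c) u" and ne: "rotate n c \<noteq> []"
    and d: "distinct (map (head G) (rotate n c))"
    by (auto simp: minimal_cycle_iff_distinct_heads closed_w_def)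
  from ne obtain e y where e: "rotate n c = e # y" by (cases "rotate n c") auto
  have "awalk (head G e) (y @ [e]) (head G e)"
    using u unfolding e awalk_append by (auto simp: awalk_simps)
  then have "closed_w (rotate (Suc n) c)" using e by (auto simp: closed_w_def)
  moreover have "distinct (map (head G) (rotate (Suc n) c))" using d e by auto
  ultimately show ?case by (simp add: minimal_cycle_iff_distinct_heads)
qed (simp add: assms)

text \<open>A closed walk that is not minimal contains a shorter one, so descent on the length ends
  at a minimal cycle.\<close>

lemma closed_w_contains_minimal_cycle:
  assumes "closed_w c"
  shows "\<exists>d. minimal_cycle d \<and> sublist d c"
  using assms
proof (induction "length c" arbitrary: c rule: less_induct)
  case less
  show ?case
  proof (cases "minimal_cycle c")
    case False
    then obtain d where d: "closed_w d" "sublist d c" "d \<noteq> c"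
      using less.prems by (auto simp: minimal_cycle_def)
    then have "length d < length c" by (auto simp: sublist_def)
    from less.hyps[OF this d(1)] show ?thesis using d(2) by (meson sublist_order.order_trans)
  qed auto
qed

text \<open>The base vertex \<open>w\<close> of the closed piece is visited at its start and again
  at its end, so the path would repeat a vertex.\<close>

lemma apath_no_closed_sublist:
  assumes "apath s p t" "closed_w c" "sublist c p"
  shows False
proof -
  from assms obtain x y where p: "p = x @ c @ y" by (auto simp: sublist_def)
  obtain w where w: "awalk w c w" "c \<noteq> []" using assms(2) by (auto simp: closed_w_def)
  have a: "awalk s p t" "distinct (awalk_verts s p)" using assms(1) by (auto simp: apath_def)
  then obtain a b where a': "awalk s x a" "awalk a c b"
    unfolding p awalk_append by blast
  have "a = w" using awalk_ends[OF a'(2) w(1)] w(2) by simp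
  have "w # map (head G) c = map (tail G) c @ [w]"
    using awalk_verts_heads[OF w(1)] awalk_verts_tails[OF w(1)] by simp
  then have "last (map (head G) c) = w" using w(2) by (metis last_ConsR last_snoc list.map_disc_iff)
  then have "w \<in> set (map (head G) c)" using w(2) by (metis last_in_set list.map_disc_iff)
  moreover have "s # map (head G) x = map (tail G) x @ [w]"
    using \<open>a = w\<close> awalk_verts_heads[OF a'(1)] awalk_verts_tails[OF a'(1)] by simp
  then have "w \<in> set (s # map (head G) x)" by (metis in_set_conv_decomp)
  moreover have "distinct (s # map (head G) p)" using a awalk_verts_heads by metis
  ultimately show False unfolding p by auto
qed

text \<open>A repeated vertex cuts out a closed walk, and this contains a minimal cycle. Conversely,
  a path has no closed piece at all.\<close>

lemma good_walk_iff_apath: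
  "good_walk p \<longleftrightarrow> (\<exists>s t. source s \<and> sink t \<and> apath s p t)"
proof
  assume g: "good_walk p"
  then obtain s t where st: "source s" "sink t" "awalk s p t" by (auto simp: good_walk_def)
  have "distinct (awalk_verts s p)"
  proof (rule ccontr)
    assume "\<not> distinct (awalk_verts s p)"
    with st(3) obtain q r z where "p = q @ r @ z" "closed_w r"
      by (rule awalk_cyc_decompE')
    then show False using g closed_w_contains_minimal_cycle[of r]
      unfolding good_walk_def by (metis sublist_appendI sublist_order.order_trans)
  qed
  then show "\<exists>s t. source s \<and> sink t \<and> apath s p t" using st by (auto simp: apath_def)
next
  assume "\<exists>s t. source s \<and> sink t \<and> apath s p t"
  then show "good_walk p" unfolding good_walk_def
    by (meson apath_no_closed_sublist awalkI_apath minimal_cycle_def)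
qed

section \<open>Arcs and vertices of a route\<close>

lemma route_arcs_cyc [simp]: "route_arcs (cyc c) = set c"
  by (auto simp: cyc_def)

text \<open>A further rotation by \<open>length c - n mod length c\<close> undoes the rotation by
  \<open>n\<close>, so \<open>c\<close> and \<open>rotate n c\<close> have the same orbit.\<close>

lemma cyc_rotate: "cyc (rotate n c) = cyc c"
proof -
  have "\<exists>m. rotate k c = rotate m (rotate n c)" for k
  proof (cases "c = []")
    case False
    have "rotate (k + (length c - n mod length c)) (rotate n c) = rotate k c"
    proof -
      have "rotate (length c - n mod length c) (rotate n c)
          = rotate (length c - n mod length c + n mod length c) c"
        by (metis rotate_conv_mod rotate_rotate)
      also have "\<dots> = c" using False by (simp add: less_imp_le)
      finally show ?thesis by (metis rotate_rotate)
    qed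
    then show ?thesis by metis
  qed simp
  then show ?thesis by (auto simp: cyc_def rotate_rotate)
qed

text \<open>In a closed walk the list of tails is the list of heads with its last entry
  \<open>u\<close> moved to the front.\<close>

lemma distinct_tails_cycle:
  assumes "minimal_cycle c"
  shows "distinct (map (tail G) c)"
proof -
  obtain u where u: "awalk u c u" "c \<noteq> []" "distinct (map (head G) c)"
    using assms by (auto simp: minimal_cycle_iff_distinct_heads closed_w_def)
  have eq: "u # map (head G) c = map (tail G) c @ [u]"
    using awalk_verts_heads[OF u(1)] awalk_verts_tails[OF u(1)] by simp
  then have "map (tail G) c = butlast (u # map (head G) c)" by (metis butlast_snoc)
  also have "\<dots> = u # butlast (map (head G) c)" using u(2) by simp
  finally have "map (tail G) c = u # butlast (map (head G) c)" .
  moreover have "map (head G) c = butlast (map (head G) c) @ [u]"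
    using eq u(2) by (metis append_butlast_last_id last_ConsR last_snoc list.map_disc_iff)
  ultimately show ?thesis using u(3) by (metis distinct1_rotate rotate1.simps(2))
qed

text \<open>No route repeats a vertex. Hence two distinct arcs into, or out of, one vertex lie on
  different routes, which is needed to obtain a framing from a bipartition.\<close>

lemma inj_on_head_tail_route:
  assumes "\<rho> \<in> Routes"
  shows "inj_on (head G) (route_arcs \<rho>)" "inj_on (tail G) (route_arcs \<rho>)"
proof -
  consider c where "\<rho> = cyc c" "minimal_cycle c"
    | p s t where "\<rho> = Walk p" "apath s p t"
    using assms by (auto simp: Routes_def Cycles_def good_routes_def good_walk_iff_apath)
  then have "inj_on (head G) (route_arcs \<rho>) \<and> inj_on (tail G) (route_arcs \<rho>)"
  proof cases
    case 1
    then show ?thesis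
      using distinct_tails_cycle minimal_cycle_iff_distinct_heads[of c] by (auto simp: distinct_map)
  next
    case 2
    then have "awalk s p t" "distinct (awalk_verts s p)" by (auto simp: apath_def)
    then have "distinct (map (head G) p)" "distinct (map (tail G) p)"
      by (metis awalk_verts_heads distinct.simps(2), metis awalk_verts_tails distinct_append)
    then show ?thesis using 2 by (simp add: distinct_map)
  qed
  then show "inj_on (head G) (route_arcs \<rho>)" "inj_on (tail G) (route_arcs \<rho>)" by auto
qed

lemma route_arcs_subset:
  assumes "\<rho> \<in> Routes"
  shows "route_arcs \<rho> \<subseteq> arcs G"
proof -
  consider c u where "\<rho> = cyc c" "awalk u c u" | p s t where "\<rho> = Walk p" "awalk s p t"
    using assms by (auto simp: Routes_def Cycles_def good_routes_def good_walk_def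
        minimal_cycle_def closed_w_def)
  then show ?thesis by cases auto
qed

text \<open>On a cycle every tail is also a head. On a walk only the initial vertex can fail to be a
  head, and it is a source.\<close>

lemma route_enters_internal:
  assumes "\<rho> \<in> Routes" "internal v" "v \<in> route_verts \<rho>"
  shows "\<exists>a\<in>route_arcs \<rho>. a \<in> in_arcs G v"
proof -
  consider c u where "\<rho> = cyc c" "awalk u c u" "c \<noteq> []"
    | p s t where "\<rho> = Walk p" "awalk s p t" "source s"
    using assms by (auto simp: Routes_def Cycles_def good_routes_def good_walk_def
        minimal_cycle_def closed_w_def)
  then have "v \<in> head G ` route_arcs \<rho>"
  proof cases
    case 1
    have "u # map (head G) c = map (tail G) c @ [u]"
      using awalk_verts_heads[OF 1(2)] awalk_verts_tails[OF 1(2)] by simp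
    moreover from this have "last (map (head G) c) = u"
      using 1(3) by (metis last_ConsR last_snoc list.map_disc_iff)
    then have "u \<in> head G ` set c" using 1(3) by (metis last_in_set list.map_disc_iff list.set_map)
    ultimately have "tail G ` set c \<subseteq> head G ` set c"
      by (metis Un_upper1 insert_absorb list.set_map list.simps(15) set_append)
    then show ?thesis using assms(3) 1 by (auto simp: route_verts_def)
  next
    case 2
    then have "s # map (head G) p = map (tail G) p @ [t]"
      using awalk_verts_heads[OF 2(2)] awalk_verts_tails[OF 2(2)] by simp
    then have "insert s (head G ` set p) = insert t (tail G ` set p)"
      by (metis list.set(2) list.set_map set_append Un_insert_right sup_bot_right empty_set)
    then show ?thesis using assms(2,3) 2 by (auto simp: route_verts_def internal_def)
  qed
  then show ?thesis using route_arcs_subset[OF assms(1)] by auto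
qed

section \<open>Cyclic ample framings\<close>

text \<open>For a cyclic ample framing this is a partial injection on the arcs, and the arcs of a
  monochromatic walk form a chain for it.\<close>

definition step :: "('b \<Rightarrow> colour) \<Rightarrow> 'b \<Rightarrow> 'b \<Rightarrow> bool" where
  "step \<kappa> a b \<longleftrightarrow> a \<in> arcs G \<and> b \<in> arcs G \<and> head G a = tail G b \<and> \<kappa> a = \<kappa> b"

lemma successively_step:
  assumes "awalk u p v" "monochromatic \<kappa> (set p)"
  shows "successively (step \<kappa>) p"
  using assms
proof (induction p arbitrary: u)
  case (Cons a p)
  then have "monochromatic \<kappa> (set p)" by (auto simp: monochromatic_def)
  with Cons show ?case
    by (cases p) (auto simp: awalk_simps monochromatic_def step_def)
qed simp

lemma minimal_cycle_monochromatic: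
  "cyclic_ample_framing \<kappa> \<Longrightarrow> minimal_cycle c \<Longrightarrow> monochromatic \<kappa> (set c)"
  by (auto simp: cyclic_ample_framing_def monochromatic_def)

lemma framing_in_unique:
  assumes "cyclic_ample_framing \<kappa>" "internal v" "a \<in> arcs G" "b \<in> arcs G"
    "head G a = v" "head G b = v" "\<kappa> a = \<kappa> b"
  shows "a = b"
  using assms unfolding cyclic_ample_framing_def by (metis in_in_arcs_conv)

lemma framing_out_unique:
  assumes "cyclic_ample_framing \<kappa>" "internal v" "a \<in> arcs G" "b \<in> arcs G"
    "tail G a = v" "tail G b = v" "\<kappa> a = \<kappa> b"
  shows "a = b"
  using assms unfolding cyclic_ample_framing_def by (metis in_out_arcs_conv)

lemma framing_in_exists:
  assumes "cyclic_ample_framing \<kappa>" "internal v"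
  obtains a where "a \<in> arcs G" "head G a = v" "\<kappa> a = k"
  using assms unfolding cyclic_ample_framing_def by (metis in_in_arcs_conv)

lemma framing_out_exists:
  assumes "cyclic_ample_framing \<kappa>" "internal v"
  obtains a where "a \<in> arcs G" "tail G a = v" "\<kappa> a = k"
  using assms unfolding cyclic_ample_framing_def by (metis in_out_arcs_conv)

end

context full_digraph
begin

lemma head_neq_source: "source s \<Longrightarrow> a \<in> arcs G \<Longrightarrow> head G a \<noteq> s"
  using finite_in_arcs[of s] by (auto simp: source_def in_degree_def in_arcs_def)

lemma tail_neq_sink: "sink t \<Longrightarrow> a \<in> arcs G \<Longrightarrow> tail G a \<noteq> t"
  using finite_out_arcs[of t] by (auto simp: sink_def out_degree_def out_arcs_def)

lemma internal_between:
  assumes "a \<in> arcs G" "b \<in> arcs G" "head G a = tail G b"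
  shows "internal (head G a)"
  using assms head_neq_source tail_neq_sink by (auto simp: internal_def)

lemma step_right_unique:
  "cyclic_ample_framing \<kappa> \<Longrightarrow> step \<kappa> a b \<Longrightarrow> step \<kappa> a c \<Longrightarrow> b = c"
  unfolding step_def by (metis framing_out_unique internal_between)

lemma step_left_unique:
  "cyclic_ample_framing \<kappa> \<Longrightarrow> step \<kappa> b a \<Longrightarrow> step \<kappa> c a \<Longrightarrow> b = c"
  unfolding step_def by (metis framing_in_unique internal_between)

text \<open>Shortening \<open>r\<close> to a path yields a minimal cycle through \<open>e\<close> and \<open>f\<close>.\<close>

lemma framing_return_walk:
  assumes \<kappa>: "cyclic_ample_framing \<kappa>"
    and "e \<in> arcs G" "f \<in> arcs G" "head G e = tail G f"
    and r: "awalk (head G f) r (tail G e)" "head G e \<notin> set (awalk_verts (head G f) r)"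
  shows "\<kappa> e = \<kappa> f"
proof -
  define q where "q = awalk_to_apath r"
  have q: "apath (head G f) q (tail G e)" "set q \<subseteq> set r"
    using apath_awalk_to_apath[OF r(1)] awalk_to_apath_subset[OF r(1)] by (auto simp: q_def)
  then have qa: "awalk (head G f) q (tail G e)" "distinct (awalk_verts (head G f) q)"
    by (auto simp: apath_def)
  have "head G e \<notin> set (awalk_verts (head G f) q)"
    using r(2) q(2) set_awalk_verts[OF qa(1)] set_awalk_verts[OF r(1)] by auto
  moreover have "awalk (tail G e) (e # f # q) (tail G e)" using qa assms by (auto simp: awalk_simps)
  then have "closed_w (e # f # q)" by (auto simp: closed_w_def)
  ultimately have "minimal_cycle (e # f # q)"
    using qa(2) unfolding awalk_verts_heads[OF qa(1)] minimal_cycle_iff_distinct_heads by auto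
  from minimal_cycle_monochromatic[OF \<kappa> this] show ?thesis by (auto simp: monochromatic_def)
qed

text \<open>By fullness in-degree and out-degree agree on \<open>D\<close>. Summing over
  \<open>D\<close> and removing the arcs inside \<open>D\<close> from both counts leaves the two
  boundaries.\<close>

lemma card_boundary:
  assumes D: "\<And>w. w \<in> D \<Longrightarrow> internal w"
  shows "card {a \<in> arcs G. tail G a \<in> D \<and> head G a \<notin> D}
       = card {a \<in> arcs G. tail G a \<notin> D \<and> head G a \<in> D}"
proof -
  have fin: "finite D" using D by (auto intro: finite_subset[OF _ finite_verts] simp: internal_def)
  have "card {a \<in> arcs G. tail G a \<in> D} = card (\<Union>w\<in>D. out_arcs G w)"
    by (rule arg_cong[where f = card]) auto
  also have "\<dots> = (\<Sum>w\<in>D. out_degree G w)"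
    unfolding out_degree_def using fin by (intro card_UN_disjoint) auto
  also have "\<dots> = (\<Sum>w\<in>D. in_degree G w)" using D full by (auto intro: sum.cong)
  also have "\<dots> = card (\<Union>w\<in>D. in_arcs G w)"
    unfolding in_degree_def using fin by (intro card_UN_disjoint[symmetric]) auto
  also have "\<dots> = card {a \<in> arcs G. head G a \<in> D}"
    by (rule arg_cong[where f = card]) auto
  finally have eq: "card {a \<in> arcs G. tail G a \<in> D} = card {a \<in> arcs G. head G a \<in> D}" .
  let ?I = "{a \<in> arcs G. tail G a \<in> D \<and> head G a \<in> D}"
  have "card {a \<in> arcs G. tail G a \<in> D \<and> head G a \<notin> D} = card ({a \<in> arcs G. tail G a \<in> D} - ?I)"
    by (rule arg_cong[where f = card]) auto
  also have "\<dots> = card ({a \<in> arcs G. head G a \<in> D} - ?I)"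
    using eq by (subst (1 2) card_Diff_subset) auto
  also have "\<dots> = card {a \<in> arcs G. tail G a \<notin> D \<and> head G a \<in> D}"
    by (rule arg_cong[where f = card]) auto
  finally show ?thesis .
qed

lemma awalk_leaves:
  assumes "awalk u p w" "u \<in> D" "w \<notin> D"
  shows "\<exists>x a y. p = x @ a # y \<and> tail G a \<in> D \<and> head G a \<notin> D"
  using assms
proof (induction p arbitrary: u)
  case (Cons b p)
  show ?case
  proof (cases "head G b \<in> D")
    case True
    then obtain x a y where "p = x @ a # y" "tail G a \<in> D" "head G a \<notin> D"
      using Cons.IH[of "head G b"] Cons.prems by (auto simp: awalk_simps)
    then show ?thesis by (intro exI[of _ "b # x"]) auto
  next
    case False
    then show ?thesis using Cons.prems by (intro exI[of _ "[]"]) (auto simp: awalk_simps)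
  qed
qed (simp add: awalk_simps)

section \<open>Routes with a change of colour\<close>

definition reach_avoiding :: "'a \<Rightarrow> 'a \<Rightarrow> 'a \<Rightarrow> bool" where
  "reach_avoiding v x y \<longleftrightarrow> (\<exists>p. awalk x p y \<and> v \<notin> set (awalk_verts x p))"

lemma reach_avoiding_refl: "x \<in> verts G \<Longrightarrow> x \<noteq> v \<Longrightarrow> reach_avoiding v x x"
  unfolding reach_avoiding_def by (intro exI[of _ "[]"]) (auto simp: awalk_simps)

lemma reach_avoiding_neq: "reach_avoiding v x y \<Longrightarrow> x \<noteq> v \<and> y \<noteq> v"
  unfolding reach_avoiding_def
  by (metis awalk_verts_heads awalk_verts_tails in_set_conv_decomp list.set_intros(1))

lemma reach_avoiding_verts: "reach_avoiding v x y \<Longrightarrow> x \<in> verts G \<and> y \<in> verts G"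
  unfolding reach_avoiding_def by auto

lemma reach_avoiding_snoc:
  assumes "reach_avoiding v x (tail G a)" "a \<in> arcs G" "head G a \<noteq> v"
  shows "reach_avoiding v x (head G a)"
proof -
  obtain p where p: "awalk x p (tail G a)" "v \<notin> set (awalk_verts x p)"
    using assms(1) by (auto simp: reach_avoiding_def)
  have "awalk x (p @ [a]) (head G a)"
    unfolding awalk_append using p(1) assms(2) by (auto simp: awalk_simps)
  then show ?thesis using p assms(3) unfolding reach_avoiding_def
    by (intro exI[of _ "p @ [a]"]) (auto simp: awalk_verts_heads[OF p(1)] awalk_verts_heads[of _ "p @ [a]"])
qed

lemma reach_avoiding_Cons:
  assumes "reach_avoiding v (head G a) y" "a \<in> arcs G" "tail G a \<noteq> v"
  shows "reach_avoiding v (tail G a) y"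
proof -
  obtain p where p: "awalk (head G a) p y" "v \<notin> set (awalk_verts (head G a) p)"
    using assms(1) by (auto simp: reach_avoiding_def)
  then show ?thesis using assms(2,3) unfolding reach_avoiding_def
    by (intro exI[of _ "a # p"]) (auto simp: awalk_simps)
qed

lemma reach_avoiding_apath:
  assumes "reach_avoiding v x y"
  obtains p where "apath x p y" "v \<notin> set (awalk_verts x p)"
proof -
  obtain p where p: "awalk x p y" "v \<notin> set (awalk_verts x p)"
    using assms by (auto simp: reach_avoiding_def)
  have q: "apath x (awalk_to_apath p) y" "set (awalk_to_apath p) \<subseteq> set p"
    using apath_awalk_to_apath[OF p(1)] awalk_to_apath_subset[OF p(1)] by auto
  then have "v \<notin> set (awalk_verts x (awalk_to_apath p))"
    using p(2) set_awalk_verts[OF awalkI_apath[OF q(1)]] set_awalk_verts[OF p(1)] by auto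
  with q(1) that show thesis by blast
qed

lemma reach_avoiding_source: "reach_avoiding v x y \<Longrightarrow> source y \<Longrightarrow> x = y"
proof -
  assume "reach_avoiding v x y" "source y"
  then obtain p where p: "awalk x p y" by (auto simp: reach_avoiding_def)
  show "x = y"
  proof (cases p rule: rev_cases)
    case (snoc q a)
    then show ?thesis using p head_neq_source[OF \<open>source y\<close>] unfolding snoc awalk_append
      by (auto simp: awalk_simps)
  qed (use p in \<open>auto simp: awalk_simps\<close>)
qed

lemma reach_avoiding_sink: "reach_avoiding v x y \<Longrightarrow> sink x \<Longrightarrow> x = y"
  unfolding reach_avoiding_def using tail_neq_sink by (metis awalk_Cons_iff awalk_Nil_iff list.exhaust)

text \<open>Serves in the contrapositive: if \<open>e\<close> and \<open>f\<close> have different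
  colours, the walk cannot come back from \<open>f\<close> to \<open>e\<close> without meeting their
  common vertex.\<close>

lemma reach_avoiding_return:
  assumes "cyclic_ample_framing \<kappa>" "e \<in> arcs G" "f \<in> arcs G" "head G e = tail G f"
    and "reach_avoiding (head G e) (head G f) (tail G e)"
  shows "\<kappa> e = \<kappa> f"
  using assms framing_return_walk unfolding reach_avoiding_def by blast

lemma good_walk_switch:
  assumes "good_walk (x @ e # f # y)"
  obtains s t where "source s" "sink t" "apath s (x @ e # f # y) t"
    "e \<in> arcs G" "f \<in> arcs G" "tail G f = head G e" "internal (head G e)"
    "awalk s x (tail G e)" "awalk (head G f) y t"
proof -
  obtain s t where st: "source s" "sink t" "apath s (x @ e # f # y) t"
    using assms by (auto simp: good_walk_iff_apath)
  then have "awalk s (x @ e # f # y) t" by (auto simp: apath_def)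
  then have "e \<in> arcs G" "f \<in> arcs G" "tail G f = head G e"
    "awalk s x (tail G e)" "awalk (head G f) y t"
    unfolding awalk_append by (auto simp: awalk_simps)
  with st that internal_between show thesis by metis
qed

text \<open>The piece from \<open>a\<close> to \<open>b\<close> would be a closed walk inside a
  path. This is the final contradiction in both reachability lemmas.\<close>

lemma good_walk_no_return:
  assumes "good_walk (x @ a # y @ b # z)" "head G b = tail G a"
  shows False
proof -
  obtain s t where st: "apath s (x @ a # y @ b # z) t"
    using assms by (auto simp: good_walk_iff_apath)
  then have "awalk s (x @ (a # y @ [b]) @ z) t" by (auto simp: apath_def)
  then obtain u w where "awalk u (a # y @ [b]) w" unfolding awalk_append by blast
  moreover from this have "u = tail G a" "w = head G b"
    unfolding awalk_append append_Cons[symmetric] by (auto simp: awalk_simps)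
  ultimately have "closed_w (a # y @ [b])" using assms(2) by (auto simp: closed_w_def)
  moreover have "sublist (a # y @ [b]) (x @ a # y @ b # z)"
    using sublist_appendI[of "a # y @ [b]" x z] by simp
  ultimately show False using st apath_no_closed_sublist by blast
qed

lemma good_walk_no_loop:
  assumes "good_walk (x @ a # y)"
  shows "head G a \<noteq> tail G a"
proof
  assume l: "head G a = tail G a"
  obtain s t where st: "apath s (x @ a # y) t"
    using assms by (auto simp: good_walk_iff_apath)
  then have "set (x @ a # y) \<subseteq> arcs G" unfolding apath_def by blast
  then have "closed_w [a]" using l by (auto simp: closed_w_def awalk_simps)
  moreover have "sublist [a] (x @ a # y)" using sublist_appendI[of "[a]" x y] by simp
  ultimately show False using st apath_no_closed_sublist by blast
qed

lemma sink_reachable_avoiding: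
  assumes \<kappa>: "cyclic_ample_framing \<kappa>"
    and good: "good_walk (x @ e # f # y)" and ne: "\<kappa> e \<noteq> \<kappa> f"
    and e': "e' \<in> arcs G" "head G e' = head G e" "\<kappa> e' = \<kappa> f"
    and f': "f' \<in> arcs G" "tail G f' = head G e" "\<kappa> f' = \<kappa> e"
  shows "\<exists>t. sink t \<and> reach_avoiding (head G e) (head G f') t"
proof (rule ccontr)
  assume no: "\<not> ?thesis"
  define v where "v = head G e"
  define D where "D = {w. reach_avoiding v (head G f') w}"
  obtain s t where st: "source s" "sink t" "e \<in> arcs G" "f \<in> arcs G" "tail G f = v" "internal v"
    "awalk s x (tail G e)"
    by (rule good_walk_switch[OF good]) (auto simp: v_def intro: that)
  \<comment> \<open>A loop \<open>f'\<close> would be the arc into \<open>v\<close> in the colour of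
    \<open>e\<close>, that is, \<open>e\<close> itself, but a good walk uses no loop.\<close>
  have "head G f' \<noteq> v"
  proof
    assume "head G f' = v"
    then have "f' = e"
      by (intro framing_in_unique[OF \<kappa> \<open>internal v\<close> f'(1) st(3)]) (auto simp: v_def f'(3))
    then show False using good_walk_no_loop[OF good] f'(2) by simp
  qed
  then have f'D: "head G f' \<in> D" using reach_avoiding_refl f'(1) by (auto simp: D_def)
  \<comment> \<open>Sinks are excluded by the assumption \<open>no\<close>. The only source that
    could be reached is the starting vertex \<open>head G f'\<close>, but \<open>f'\<close> enters
    it.\<close>
  have D: "internal w" if "w \<in> D" for w
    using that no reach_avoiding_verts[of v "head G f'" w] reach_avoiding_source[of v "head G f'" w]
      head_neq_source[of "head G f'" f'] f'(1)
    by (auto simp: D_def internal_def v_def)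
  have "v \<notin> D" using reach_avoiding_neq by (auto simp: D_def)
  define Out where "Out = {a \<in> arcs G. tail G a \<in> D \<and> head G a \<notin> D}"
  define In where "In = {a \<in> arcs G. tail G a \<notin> D \<and> head G a \<in> D}"
  have Out: "Out \<subseteq> {e}"
  proof
    fix a assume "a \<in> Out"
    \<comment> \<open>With any other head the arc would extend a walk that avoids \<open>v\<close>,
      and its head would lie in \<open>D\<close>.\<close>
    then have a: "a \<in> arcs G" "tail G a \<in> D" "head G a = v"
      using reach_avoiding_snoc by (auto simp: Out_def D_def)
    have "\<kappa> a \<noteq> \<kappa> f"
    proof
      assume "\<kappa> a = \<kappa> f"
      then have "a = e'"
        using a e' by (intro framing_in_unique[OF \<kappa> \<open>internal v\<close> a(1) e'(1)]) (auto simp: v_def)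
      \<comment> \<open>A way from \<open>f'\<close> back to \<open>e'\<close> within
        \<open>D\<close> closes a minimal cycle with two colours.\<close>
      then have "\<kappa> e' = \<kappa> f'"
        using reach_avoiding_return[OF \<kappa> e'(1) f'(1)] a(2) e' f' by (simp add: D_def v_def)
      then show False using ne e' f' by simp
    qed
    then have "\<kappa> a = \<kappa> e" using ne colour_eq by blast
    then have "a = e"
      using a by (intro framing_in_unique[OF \<kappa> \<open>internal v\<close> a(1) st(3)]) (auto simp: v_def)
    then show "a \<in> {e}" by simp
  qed
  have "f' \<in> In" using f' f'D \<open>v \<notin> D\<close> by (auto simp: In_def v_def)
  moreover have fin: "finite In" by (auto simp: In_def)
  moreover have eq: "card Out = card In" unfolding Out_def In_def using D by (rule card_boundary)
  moreover have "card Out \<le> 1" using card_mono[OF _ Out] by simp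
  ultimately have "In = {f'}" using card_le_Suc0_iff_eq[OF fin] by auto
  then have "Out \<noteq> {}" using eq by auto
  then have "tail G e \<in> D" using Out by (auto simp: Out_def)
  moreover have "s \<notin> D" using D st(1) by (auto simp: internal_def)
  \<comment> \<open>The walk \<open>x\<close> leads from the source \<open>s\<close> outside
    \<open>D\<close> to \<open>tail G e\<close> in \<open>D\<close>, so it leaves the complement of
    \<open>D\<close>. It can do so only through \<open>f'\<close>, so it visits \<open>v\<close>
    before \<open>e\<close> leads there again.\<close>
  ultimately obtain x1 a x2 where a: "x = x1 @ a # x2" "tail G a \<notin> D" "head G a \<in> D"
    using awalk_leaves[OF st(7), of "- D"] by auto
  then have "a \<in> In" using st(7) by (auto simp: In_def)
  then have "a = f'" using \<open>In = {f'}\<close> by simp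
  then show False using good_walk_no_return[of x1 f' x2 e "f # y"] good a(1) f'(2) by simp
qed

text \<open>The argument of \<open>sink_reachable_avoiding\<close> with all arcs reversed: now
  \<open>f\<close> is the only arc into \<open>D\<close> and \<open>e'\<close> the only arc out of
  it, so \<open>y\<close> must leave \<open>D\<close> through \<open>e'\<close> and return to
  \<open>v\<close>.\<close>

lemma source_reachable_avoiding:
  assumes \<kappa>: "cyclic_ample_framing \<kappa>"
    and good: "good_walk (x @ e # f # y)" and ne: "\<kappa> e \<noteq> \<kappa> f"
    and e': "e' \<in> arcs G" "head G e' = head G e" "\<kappa> e' = \<kappa> f"
    and f': "f' \<in> arcs G" "tail G f' = head G e" "\<kappa> f' = \<kappa> e"
  shows "\<exists>s. source s \<and> reach_avoiding (head G e) s (tail G e')"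
proof (rule ccontr)
  assume no: "\<not> ?thesis"
  define v where "v = head G e"
  define D where "D = {w. reach_avoiding v w (tail G e')}"
  obtain s t where st: "source s" "sink t" "e \<in> arcs G" "f \<in> arcs G" "tail G f = v" "internal v"
    "awalk (head G f) y t"
    by (rule good_walk_switch[OF good]) (auto simp: v_def intro: that)
  have "tail G e' \<noteq> v"
  proof
    assume "tail G e' = v"
    then have "e' = f"
      by (intro framing_out_unique[OF \<kappa> \<open>internal v\<close> e'(1) st(4)]) (auto simp: e'(3) st(5))
    then show False using good_walk_no_loop[of "x @ [e]" f y] good e'(2) st(5) by (simp add: v_def)
  qed
  then have e'D: "tail G e' \<in> D" using reach_avoiding_refl e'(1) by (auto simp: D_def)
  have D: "internal w" if "w \<in> D" for w
    using that no reach_avoiding_verts[of v w "tail G e'"] reach_avoiding_sink[of v w "tail G e'"]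
      tail_neq_sink[of "tail G e'" e'] e'(1)
    by (auto simp: D_def internal_def v_def)
  have "v \<notin> D" using reach_avoiding_neq by (auto simp: D_def)
  define Out where "Out = {a \<in> arcs G. tail G a \<in> D \<and> head G a \<notin> D}"
  define In where "In = {a \<in> arcs G. tail G a \<notin> D \<and> head G a \<in> D}"
  have In: "In \<subseteq> {f}"
  proof
    fix a assume "a \<in> In"
    then have a: "a \<in> arcs G" "head G a \<in> D" "tail G a = v"
      using reach_avoiding_Cons by (auto simp: In_def D_def)
    have "\<kappa> a \<noteq> \<kappa> e"
    proof
      assume "\<kappa> a = \<kappa> e"
      then have "a = f'"
        using a f' by (intro framing_out_unique[OF \<kappa> \<open>internal v\<close> a(1) f'(1)]) (auto simp: v_def)
      then have "\<kappa> e' = \<kappa> f'"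
        using reach_avoiding_return[OF \<kappa> e'(1) f'(1)] a(2) e' f' by (simp add: D_def v_def)
      then show False using ne e' f' by simp
    qed
    then have "\<kappa> a = \<kappa> f" using ne colour_eq by metis
    then have "a = f"
      using a st(5) by (intro framing_out_unique[OF \<kappa> \<open>internal v\<close> a(1) st(4)]) auto
    then show "a \<in> {f}" by simp
  qed
  have "e' \<in> Out" using e' e'D \<open>v \<notin> D\<close> by (auto simp: Out_def v_def)
  moreover have fin: "finite Out" by (auto simp: Out_def)
  moreover have eq: "card Out = card In" unfolding Out_def In_def using D by (rule card_boundary)
  moreover have "card In \<le> 1" using card_mono[OF _ In] by simp
  ultimately have "Out = {e'}" using card_le_Suc0_iff_eq[OF fin] by auto
  then have "In \<noteq> {}" using eq by auto
  then have "head G f \<in> D" using In by (auto simp: In_def)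
  moreover have "t \<notin> D" using D st(2) by (auto simp: internal_def)
  ultimately obtain y1 a y2 where a: "y = y1 @ a # y2" "tail G a \<in> D" "head G a \<notin> D"
    using awalk_leaves[OF st(7), of D] by auto
  then have "a \<in> Out" using st(7) by (auto simp: Out_def)
  then have "a = e'" using \<open>Out = {e'}\<close> by simp
  then show False using good_walk_no_return[of "x @ [e]" f y1 e' y2] good a(1) e'(2) st(5)
    by (simp add: v_def)
qed

lemma incompatible_if_switch:
  assumes \<kappa>: "cyclic_ample_framing \<kappa>"
    and good: "good_walk (x @ e # f # y)" and ne: "\<kappa> e \<noteq> \<kappa> f"
  shows "\<exists>p. good_walk p \<and> incompatible \<kappa> (Walk (x @ e # f # y)) (Walk p)"
proof -
  define v where "v = head G e"
  have v: "internal v" by (rule good_walk_switch[OF good]) (simp add: v_def)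
  obtain e' where e': "e' \<in> arcs G" "head G e' = v" "\<kappa> e' = \<kappa> f"
    using framing_in_exists[OF \<kappa> v] by metis
  obtain f' where f': "f' \<in> arcs G" "tail G f' = v" "\<kappa> f' = \<kappa> e"
    using framing_out_exists[OF \<kappa> v] by metis
  obtain s where s: "source s" "reach_avoiding v s (tail G e')"
    using source_reachable_avoiding[OF \<kappa> good ne] e' f' unfolding v_def by metis
  obtain t where t: "sink t" "reach_avoiding v (head G f') t"
    using sink_reachable_avoiding[OF \<kappa> good ne] e' f' unfolding v_def by metis
  obtain p where p: "apath s p (tail G e')" "v \<notin> set (awalk_verts s p)"
    using reach_avoiding_apath[OF s(2)] .
  obtain q where q: "apath (head G f') q t" "v \<notin> set (awalk_verts (head G f') q)"
    using reach_avoiding_apath[OF t(2)] .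
  have pa: "awalk s p (tail G e')" "distinct (awalk_verts s p)"
    and qa: "awalk (head G f') q t" "distinct (awalk_verts (head G f') q)"
    using p(1) q(1) by (auto simp: apath_def)
  \<comment> \<open>At a common vertex \<open>w\<close> the start of \<open>q\<close> and the end of
    \<open>p\<close> can be joined to a walk from \<open>f'\<close> to \<open>e'\<close> that avoids
    \<open>v\<close>, although these arcs have different colours.\<close>
  have disj: "set (awalk_verts s p) \<inter> set (awalk_verts (head G f') q) = {}"
  proof (rule ccontr)
    assume "\<not> ?thesis"
    then obtain w where w: "w \<in> set (awalk_verts s p)" "w \<in> set (awalk_verts (head G f') q)" by auto
    obtain p1 p2 where p12: "p = p1 @ p2" "awalk s p1 w" "awalk w p2 (tail G e')"
      using awalk_decomp[OF pa(1) w(1)] by auto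
    obtain q1 q2 where q12: "q = q1 @ q2" "awalk (head G f') q1 w" "awalk w q2 t"
      using awalk_decomp[OF qa(1) w(2)] by auto
    have "set (awalk_verts (head G f') (q1 @ p2)) \<subseteq> set (awalk_verts (head G f') q) \<union> set (awalk_verts s p)"
      unfolding set_awalk_verts_append[OF q12(2) p12(3)]
      using set_awalk_verts_append[OF q12(2,3)] set_awalk_verts_append[OF p12(2,3)] p12(1) q12(1) by auto
    then have "v \<notin> set (awalk_verts (head G f') (q1 @ p2))" using p(2) q(2) by auto
    moreover have "awalk (head G f') (q1 @ p2) (tail G e')"
      unfolding awalk_append using p12 q12 by auto
    ultimately have "reach_avoiding v (head G f') (tail G e')" unfolding reach_avoiding_def by blast
    then show False using reach_avoiding_return[OF \<kappa> e'(1) f'(1)] e' f' ne by simp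
  qed
  let ?r = "p @ e' # f' # q"
  have r: "awalk s ?r t" unfolding awalk_append using pa qa e' f' by (auto simp: awalk_simps)
  have "awalk_verts s ?r = awalk_verts s p @ v # awalk_verts (head G f') q"
    unfolding awalk_verts_heads[OF r] awalk_verts_heads[OF pa(1)] awalk_verts_heads[OF qa(1)]
    using e' by simp
  then have "distinct (awalk_verts s ?r)" using pa(2) qa(2) disj p(2) q(2) by auto
  then have "good_walk ?r" using r s(1) t(1) by (auto simp: good_walk_iff_apath apath_def)
  \<comment> \<open>The common subwalk is the single vertex \<open>v\<close>, so
    \<open>S = []\<close>.\<close>
  moreover have "incompatible \<kappa> (Walk (x @ e # f # y)) (Walk ?r)"
    unfolding incompatible_def
    by (rule exI[of _ "x @ [e]"], rule exI[of _ "[]"], rule exI[of _ "f # y"],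
        rule exI[of _ "p @ [e']"], rule exI[of _ "f' # q"])
       (use e' f' ne in \<open>auto simp: v_def\<close>)
  ultimately show ?thesis by blast
qed

text \<open>A route with both colours is not a cycle, so it is a walk with a switch and
  \<open>incompatible_if_switch\<close> applies. Conversely, incompatibility requires both colours
  on each of the two walks.\<close>

lemma exceptional_routes_eq:
  assumes \<kappa>: "cyclic_ample_framing \<kappa>"
  shows "exceptional_routes \<kappa> = {\<rho> \<in> Routes. monochromatic \<kappa> (route_arcs \<rho>)}"
proof (intro equalityI subsetI)
  fix \<rho> assume "\<rho> \<in> exceptional_routes \<kappa>"
  then have \<rho>: "\<rho> \<in> Routes" "\<And>\<rho>'. \<rho>' \<in> Routes \<Longrightarrow> \<not> incompatible \<kappa> \<rho> \<rho>'"
    by (auto simp: exceptional_routes_def)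
  have "monochromatic \<kappa> (route_arcs \<rho>)"
  proof (rule ccontr)
    assume nm: "\<not> monochromatic \<kappa> (route_arcs \<rho>)"
    then obtain p where p: "\<rho> = Walk p" "good_walk p"
      using \<rho>(1) minimal_cycle_monochromatic[OF \<kappa>] by (auto simp: Routes_def Cycles_def good_routes_def)
    with nm obtain x e f y where "p = x @ e # f # y" "\<kappa> e \<noteq> \<kappa> f"
      using not_constant_split[of p \<kappa>] by (auto simp: monochromatic_def)
    then obtain q where "good_walk q" "incompatible \<kappa> \<rho> (Walk q)"
      using incompatible_if_switch[OF \<kappa>] p by metis
    then show False using \<rho>(2)[of "Walk q"] by (auto simp: Routes_def good_routes_def)
  qed
  with \<rho> show "\<rho> \<in> {\<rho> \<in> Routes. monochromatic \<kappa> (route_arcs \<rho>)}" by simp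
next
  fix \<rho> assume "\<rho> \<in> {\<rho> \<in> Routes. monochromatic \<kappa> (route_arcs \<rho>)}"
  then show "\<rho> \<in> exceptional_routes \<kappa>"
    by (auto simp: exceptional_routes_def monochromatic_def incompatible_def)
qed

section \<open>Monochromatic routes\<close>

text \<open>
  If \<open>e\<close> lies on no minimal cycle, then a longest path through \<open>e\<close> in the colour of \<open>e\<close> is a
  good route.
\<close>

lemma mono_route_exists:
  assumes \<kappa>: "cyclic_ample_framing \<kappa>" and e: "e \<in> arcs G"
  shows "\<exists>\<rho>\<in>Routes. monochromatic \<kappa> (route_arcs \<rho>) \<and> e \<in> route_arcs \<rho>"
proof (cases "\<exists>c. minimal_cycle c \<and> e \<in> set c")
  case True
  then obtain c where c: "minimal_cycle c" "e \<in> set c" by auto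
  then show ?thesis using minimal_cycle_monochromatic[OF \<kappa> c(1)]
    by (intro bexI[of _ "cyc c"]) (auto simp: Routes_def Cycles_def)
next
  case no_cycle: False
  define k where "k = \<kappa> e"
  define P where "P p \<longleftrightarrow> (\<exists>u w. apath u p w) \<and> e \<in> set p \<and> (\<forall>a\<in>set p. \<kappa> a = k)" for p
  have "tail G e \<noteq> head G e"
  proof
    assume "tail G e = head G e"
    then have "minimal_cycle [e]" using e
      by (auto simp: minimal_cycle_iff_distinct_heads closed_w_def awalk_simps)
    then show False using no_cycle by auto
  qed
  then have "P [e]" using e by (auto simp: P_def apath_simps k_def)
  moreover have "\<forall>q. P q \<longrightarrow> length q < card (verts G)" using length_apath_less by (auto simp: P_def)
  ultimately obtain p where p: "P p" "\<And>q. P q \<Longrightarrow> length q \<le> length p"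
    using ex_has_greatest_nat[of P "[e]" length "card (verts G)"] by auto
  from p(1) obtain u w where uw: "apath u p w" by (auto simp: P_def)
  then have a: "awalk u p w" "distinct (awalk_verts u p)" by (auto simp: apath_def)
  have pk: "e \<in> set p" "\<And>a. a \<in> set p \<Longrightarrow> \<kappa> a = k" using p(1) by (auto simp: P_def)
  have verts: "awalk_verts u p = u # map (head G) p" "awalk_verts u p = map (tail G) p @ [w]"
    using awalk_verts_heads[OF a(1)] awalk_verts_tails[OF a(1)] by blast+
  have arcs: "set p \<subseteq> arcs G" using a(1) by auto
  have set_heads: "set (awalk_verts u p) = insert u (head G ` set p)" unfolding verts(1) by simp
  have set_tails: "set (awalk_verts u p) = insert w (tail G ` set p)" unfolding verts(2) by simp
  have u_head: "u \<notin> head G ` set p" using a(2) unfolding verts(1) by simp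
  have w_tail: "w \<notin> tail G ` set p" using a(2) unfolding verts(2) by simp
  have "u \<noteq> w" using uw pk(1) apath_nonempty_ends by fastforce
  have u_tail: "u \<in> tail G ` set p" using \<open>u \<noteq> w\<close> set_heads set_tails by (metis insertE insertI1)
  have w_head: "w \<in> head G ` set p" using \<open>u \<noteq> w\<close> set_heads set_tails by (metis insertE insertI1)
  have "source u"
  proof (rule ccontr)
    assume ns: "\<not> source u"
    then have "internal u" using u_tail arcs tail_neq_sink a(1) by (auto simp: internal_def)
    then obtain g where g: "g \<in> arcs G" "head G g = u" "\<kappa> g = k"
      using framing_in_exists[OF \<kappa>] by metis
    have "g \<notin> set p" using g(2) u_head by auto
    have "tail G g \<in> set (awalk_verts u p)"
    proof (rule ccontr)
      assume "tail G g \<notin> set (awalk_verts u p)"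
      then have "P (g # p)" using uw g pk by (auto simp: P_def apath_simps)
      then show False using p(2) by fastforce
    qed
    \<comment> \<open>If \<open>g\<close> starts at the end \<open>w\<close> of the path, then
      \<open>g # p\<close> is a minimal cycle through \<open>e\<close>. Otherwise \<open>g\<close>
      and \<open>b\<close> leave an internal vertex in the same colour, so they are equal, although
      no arc of \<open>p\<close> enters \<open>u\<close>.\<close>
    then consider "tail G g = w" | b where "b \<in> set p" "tail G b = tail G g"
      unfolding set_tails by auto
    then show False
    proof cases
      case 1
      then have "awalk w (g # p) w" using a(1) g by (auto simp: awalk_simps)
      then have "minimal_cycle (g # p)" using a(2) g(2) unfolding verts(1)
        by (auto simp: minimal_cycle_iff_distinct_heads closed_w_def)
      then show False using no_cycle pk(1) by auto
    next
      case 2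
      then have "tail G g \<in> insert w (tail G ` set p)" by (metis image_eqI insertI2)
      then have "tail G g \<in> insert u (head G ` set p)" unfolding set_heads[symmetric] set_tails .
      then have "internal (tail G g)"
        using \<open>internal u\<close> internal_between[OF _ g(1)] arcs by auto
      then have "b = g" using 2 g arcs pk by (intro framing_out_unique[OF \<kappa>]) auto
      then show False using 2 \<open>g \<notin> set p\<close> by simp
    qed
  qed
  moreover have "sink w"
  proof (rule ccontr)
    assume ns: "\<not> sink w"
    then have "internal w" using w_head arcs head_neq_source a(1) by (auto simp: internal_def)
    then obtain g where g: "g \<in> arcs G" "tail G g = w" "\<kappa> g = k"
      using framing_out_exists[OF \<kappa>] by metis
    have "g \<notin> set p" using g(2) w_tail by auto
    have "head G g \<in> set (awalk_verts u p)"
    proof (rule ccontr)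
      assume n: "head G g \<notin> set (awalk_verts u p)"
      have "awalk u (p @ [g]) (head G g)"
        unfolding awalk_append using a(1) g by (auto simp: awalk_simps)
      then have "apath u (p @ [g]) (head G g)" using a(2) n verts(1)
        by (auto simp: apath_def awalk_verts_heads[of u "p @ [g]"])
      then have "P (p @ [g])" using g pk by (auto simp: P_def)
      then show False using p(2) by fastforce
    qed
    \<comment> \<open>Now \<open>u\<close> is known to be a source, so \<open>g\<close> cannot end
      there. This excludes a cycle, and only the case of a second arc of colour \<open>k\<close>
      into an internal vertex remains.\<close>
    then have "head G g \<in> head G ` set p" "head G g \<in> insert w (tail G ` set p)"
      using head_neq_source[OF \<open>source u\<close> g(1)] unfolding set_tails[symmetric] set_heads by auto
    then obtain b where b: "b \<in> set p" "head G b = head G g" "internal (head G g)"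
      using \<open>internal w\<close> internal_between g(1) arcs by force
    then have "b = g" using g arcs pk by (intro framing_in_unique[OF \<kappa>]) auto
    then show False using b \<open>g \<notin> set p\<close> by simp
  qed
  ultimately have "good_walk p" using uw by (auto simp: good_walk_iff_apath)
  then show ?thesis using pk
    by (intro bexI[of _ "Walk p"]) (auto simp: Routes_def good_routes_def monochromatic_def)
qed

section \<open>Uniqueness of the monochromatic route through an arc\<close>

lemma awalk_from_sink: "awalk t z w \<Longrightarrow> sink t \<Longrightarrow> z = []"
  using tail_neq_sink by (cases z) (auto simp: awalk_simps)

lemma awalk_to_source: "awalk u z s \<Longrightarrow> source s \<Longrightarrow> z = []"
  using head_neq_source by (cases z rule: rev_cases) (auto simp: awalk_simps simp del: awalk_append_iff simp: awalk_append)

lemma mono_prefix_cases: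
  assumes \<kappa>: "cyclic_ample_framing \<kappa>"
    and "awalk u (e # y) v" "monochromatic \<kappa> (set (e # y))"
    and "awalk u' (e # y') v'" "monochromatic \<kappa> (set (e # y'))"
  shows "prefix y y' \<or> prefix y' y"
  by (rule successively_prefix_cases[of "step \<kappa>"])
     (use step_right_unique[OF \<kappa>] successively_step assms(2-) in blast)+

text \<open>Reversing the lists turns left uniqueness of \<open>step\<close> into right uniqueness
  of its converse.\<close>

lemma mono_suffix_cases:
  assumes \<kappa>: "cyclic_ample_framing \<kappa>"
    and "awalk u (x @ [e]) v" "monochromatic \<kappa> (set (x @ [e]))"
    and "awalk u' (x' @ [e]) v'" "monochromatic \<kappa> (set (x' @ [e]))"
  shows "suffix x x' \<or> suffix x' x"
proof -
  have "successively (\<lambda>a b. step \<kappa> b a) (rev (x @ [e]))" "successively (\<lambda>a b. step \<kappa> b a) (rev (x' @ [e]))"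
    unfolding successively_rev using successively_step assms(2-) by blast+
  then have "prefix (rev x) (rev x') \<or> prefix (rev x') (rev x)"
    using successively_prefix_cases[of "\<lambda>a b. step \<kappa> b a" e "rev x" "rev x'"] step_left_unique[OF \<kappa>]
    by auto
  then show ?thesis by (simp add: suffix_to_prefix)
qed

text \<open>A cycle has no base point, so a representative that starts with \<open>e\<close> can be
  chosen for comparison with another walk from \<open>e\<close> on.\<close>

lemma cycle_from_arc:
  assumes "minimal_cycle c" "e \<in> set c"
  obtains z where "minimal_cycle (e # z)" "cyc (e # z) = cyc c" "set (e # z) = set c"
    "awalk (tail G e) (e # z) (tail G e)"
proof -
  obtain x y where c: "c = x @ e # y" using assms(2) by (auto simp: in_set_conv_decomp)
  then have r: "rotate (length x) c = e # y @ x" by (simp add: rotate_append)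
  have m: "minimal_cycle (e # y @ x)" using minimal_cycle_rotate[OF assms(1)] r by metis
  then have "awalk (tail G e) (e # y @ x) (tail G e)"
    by (auto simp: minimal_cycle_def closed_w_def awalk_Cons_iff)
  then show thesis using that[OF m] cyc_rotate r c by (metis set_rotate)
qed

text \<open>Once both cycles start with \<open>e\<close>, one is a prefix of the other, and
  minimality of the longer one makes them equal.\<close>

lemma mono_cycle_unique:
  assumes \<kappa>: "cyclic_ample_framing \<kappa>" and c: "minimal_cycle c" "e \<in> set c"
    and c': "minimal_cycle c'" "e \<in> set c'"
  shows "cyc c = cyc c'"
proof -
  obtain z where z: "minimal_cycle (e # z)" "cyc (e # z) = cyc c" "awalk (tail G e) (e # z) (tail G e)"
    using cycle_from_arc[OF c] by metis
  obtain z' where z': "minimal_cycle (e # z')" "cyc (e # z') = cyc c'" "awalk (tail G e) (e # z') (tail G e)"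
    using cycle_from_arc[OF c'] by metis
  have "prefix z z' \<or> prefix z' z"
    using mono_prefix_cases[OF \<kappa> z(3) minimal_cycle_monochromatic[OF \<kappa> z(1)]
        z'(3) minimal_cycle_monochromatic[OF \<kappa> z'(1)]] .
  then have "sublist (e # z) (e # z') \<or> sublist (e # z') (e # z)"
    by (meson Cons_prefix_Cons prefix_imp_sublist)
  then have "e # z = e # z'" using z(1) z'(1) unfolding minimal_cycle_def by metis
  then show ?thesis using z z' by simp
qed

text \<open>From \<open>e\<close> on, either the walk runs through the whole cycle and is not good,
  or the cycle follows the walk to its sink, which no closed walk can leave.\<close>

lemma mono_walk_not_cycle:
  assumes \<kappa>: "cyclic_ample_framing \<kappa>" and c: "minimal_cycle c" "e \<in> set c"
    and p: "good_walk p" "monochromatic \<kappa> (set p)" "e \<in> set p"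
  shows False
proof -
  obtain z where z: "minimal_cycle (e # z)" "awalk (tail G e) (e # z) (tail G e)"
    using cycle_from_arc[OF c] by metis
  obtain x y where xy: "p = x @ e # y" using p(3) by (auto simp: in_set_conv_decomp)
  obtain s t where st: "sink t" "awalk s p t" using p(1) by (auto simp: good_walk_def)
  then have y: "awalk (tail G e) (e # y) t" unfolding xy awalk_append by (auto simp: awalk_simps)
  have "monochromatic \<kappa> (set (e # y))" using p(2) by (auto simp: monochromatic_def xy)
  then have "prefix z y \<or> prefix y z"
    using mono_prefix_cases[OF \<kappa> z(2) minimal_cycle_monochromatic[OF \<kappa> z(1)] y] by blast
  then show False
  proof
    assume "prefix z y"
    then have "p = x @ (e # z) @ drop (length z) y" unfolding xy by (auto simp: prefix_def)
    then have "sublist (e # z) p" by (metis sublist_appendI)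
    then show False using p(1) z(1) by (auto simp: good_walk_def)
  next
    assume "prefix y z"
    then obtain z' where "z = y @ z'" by (auto simp: prefix_def)
    then have "awalk (tail G e) ((e # y) @ z') (tail G e)" using z(2) by simp
    then obtain w where w: "awalk (tail G e) (e # y) w" "awalk w z' (tail G e)"
      unfolding awalk_append by blast
    have "w = t" using awalk_ends[OF w(1) y] by simp
    then have "z' = []" using w(2) awalk_from_sink st(1) by blast
    then have "tail G e = t" using w(2) \<open>w = t\<close> by (simp add: awalk_Nil_iff)
    then show False using tail_neq_sink[OF st(1)] y by (simp add: awalk_Cons_iff)
  qed
qed

text \<open>Both walks are cut at \<open>e\<close>. Their continuations are comparable as prefixes
  and neither can go on beyond a sink; dually, the initial parts are comparable as suffixes and
  neither can extend back beyond a source.\<close>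

lemma mono_walk_unique:
  assumes \<kappa>: "cyclic_ample_framing \<kappa>"
    and p: "good_walk p" "monochromatic \<kappa> (set p)" "e \<in> set p"
    and p': "good_walk p'" "monochromatic \<kappa> (set p')" "e \<in> set p'"
  shows "p = p'"
proof -
  have *: "\<exists>x y s t. q = x @ e # y \<and> source s \<and> sink t \<and> awalk s (x @ [e]) (head G e) \<and> awalk s x (tail G e)
      \<and> awalk (tail G e) (e # y) t \<and> awalk (head G e) y t
      \<and> monochromatic \<kappa> (set (x @ [e])) \<and> monochromatic \<kappa> (set (e # y))"
    if q: "good_walk q" "monochromatic \<kappa> (set q)" "e \<in> set q" for q
  proof -
    obtain x y where xy: "q = x @ e # y" using q(3) by (auto simp: in_set_conv_decomp)
    obtain s t where st: "source s" "sink t" "awalk s q t" using q(1) by (auto simp: good_walk_def)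
    then have "awalk s x (tail G e)" "e \<in> arcs G" "awalk (head G e) y t"
      unfolding xy awalk_append by (auto simp: awalk_simps)
    moreover from this have "awalk s (x @ [e]) (head G e)" "awalk (tail G e) (e # y) t"
      unfolding awalk_append by (auto simp: awalk_simps)
    moreover have "monochromatic \<kappa> (set (x @ [e]))" "monochromatic \<kappa> (set (e # y))"
      using q(2) by (auto simp: monochromatic_def xy)
    ultimately show ?thesis using xy st by blast
  qed
  obtain x y s t where q: "p = x @ e # y" "source s" "sink t" "awalk s (x @ [e]) (head G e)"
    "awalk s x (tail G e)" "awalk (tail G e) (e # y) t" "awalk (head G e) y t"
    "monochromatic \<kappa> (set (x @ [e]))" "monochromatic \<kappa> (set (e # y))"
    using *[OF p] by blast
  obtain x' y' s' t' where q': "p' = x' @ e # y'" "source s'" "sink t'" "awalk s' (x' @ [e]) (head G e)"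
    "awalk s' x' (tail G e)" "awalk (tail G e) (e # y') t'" "awalk (head G e) y' t'"
    "monochromatic \<kappa> (set (x' @ [e]))" "monochromatic \<kappa> (set (e # y'))"
    using *[OF p'] by blast
  have y: "b = a" if ab: "prefix a b" "awalk u a v" "awalk u b v'" "sink v" for a b u v v'
  proof -
    obtain z where z: "b = a @ z" using ab(1) by (auto simp: prefix_def)
    then have "awalk v z v'" using ab(2,3) by (metis awalk_append_iff awlast_of_awalk awalkE')
    then show ?thesis using awalk_from_sink[OF _ ab(4)] z by simp
  qed
  have x: "b = a" if ab: "suffix a b" "awalk u a v" "awalk u' b v" "source u" for a b u v u'
  proof -
    obtain z where z: "b = z @ a" using ab(1) by (auto simp: suffix_def)
    then obtain w where w: "awalk u' z w" "awalk w a v" using ab(3) awalk_append by blast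
    show ?thesis
    \<comment> \<open>The empty list is a walk at every vertex, so its arcs do not determine where
      it starts.\<close>
    proof (cases "a = []")
      case True
      then show ?thesis using w ab awalk_to_source z by (metis append_Nil2 awalk_Nil_iff)
    next
      case False
      then have "w = u" using awalk_ends[OF w(2) ab(2)] by simp
      then show ?thesis using awalk_to_source[OF w(1)] ab(4) z by simp
    qed
  qed
  have "y = y'"
    using mono_prefix_cases[OF \<kappa> q(6,9) q'(6,9)] y[OF _ q(7) q'(7) q(3)] y[OF _ q'(7) q(7) q'(3)] by auto
  moreover have "x = x'"
    using mono_suffix_cases[OF \<kappa> q(4,8) q'(4,8)] x[OF _ q(5) q'(5) q(2)] x[OF _ q'(5) q(5) q'(2)] by auto
  ultimately show ?thesis using q(1) q'(1) by simp
qed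

lemma mono_route_unique:
  assumes \<kappa>: "cyclic_ample_framing \<kappa>"
    and \<rho>: "\<rho> \<in> Routes" "monochromatic \<kappa> (route_arcs \<rho>)" "e \<in> route_arcs \<rho>"
    and \<rho>': "\<rho>' \<in> Routes" "monochromatic \<kappa> (route_arcs \<rho>')" "e \<in> route_arcs \<rho>'"
  shows "\<rho> = \<rho>'"
proof -
  consider c where "\<rho> = cyc c" "minimal_cycle c" | p where "\<rho> = Walk p" "good_walk p"
    using \<rho>(1) by (auto simp: Routes_def Cycles_def good_routes_def)
  moreover consider c where "\<rho>' = cyc c" "minimal_cycle c" | p where "\<rho>' = Walk p" "good_walk p"
    using \<rho>'(1) by (auto simp: Routes_def Cycles_def good_routes_def)
  ultimately show ?thesis
    using \<rho>(2,3) \<rho>'(2,3) mono_cycle_unique[OF \<kappa>] mono_walk_not_cycle[OF \<kappa>] mono_walk_unique[OF \<kappa>]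
    by (metis route_arcs.simps(1) route_arcs_cyc)
qed

text \<open>The empty walk would need a vertex that is both a source and a sink, but a source has
  out-degree one.\<close>

lemma route_arcs_nonempty: "\<rho> \<in> Routes \<Longrightarrow> \<exists>e\<in>arcs G. e \<in> route_arcs \<rho>"
proof -
  assume \<rho>: "\<rho> \<in> Routes"
  have "route_arcs \<rho> \<noteq> {}"
  proof
    assume "route_arcs \<rho> = {}"
    then have "\<rho> = Walk []" using \<rho>
      by (auto simp: Routes_def Cycles_def good_routes_def minimal_cycle_def closed_w_def)
    moreover have "Walk [] \<noteq> cyc c" for c by (simp add: cyc_def)
    ultimately obtain s where "source s" "sink s" using \<rho>
      by (auto simp: Routes_def Cycles_def good_routes_def good_walk_def awalk_simps)
    then show False using degree_source by (auto simp: sink_def)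
  qed
  then show ?thesis using route_arcs_subset[OF \<rho>] by auto
qed

section \<open>The three conditions hold for exceptional routes\<close>

lemma exceptional_ex1:
  assumes \<kappa>: "cyclic_ample_framing \<kappa>" and "e \<in> arcs G"
  shows "\<exists>!\<rho>. \<rho> \<in> exceptional_routes \<kappa> \<and> e \<in> route_arcs \<rho>"
  using mono_route_exists[OF assms] mono_route_unique[OF \<kappa>] unfolding exceptional_routes_eq[OF \<kappa>]
  by blast

text \<open>Only routes of the form \<open>Walk\<close> can be incompatible, so this holds for every
  colouring.\<close>

lemma Cycles_exceptional: "Cycles \<subseteq> exceptional_routes \<kappa>"
  by (auto simp: exceptional_routes_def Routes_def Cycles_def incompatible_def cyc_def)

text \<open>Exceptional routes are monochromatic, and their colours give the two sides.\<close>

lemma bipartite_exceptional: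
  assumes \<kappa>: "cyclic_ample_framing \<kappa>"
  shows "bipartite (Adj (exceptional_routes \<kappa>))"
proof -
  let ?X = "exceptional_routes \<kappa>"
  \<comment> \<open>Routes of the same colour enter \<open>v\<close> by the same arc, and an arc
    lies on only one exceptional route.\<close>
  have *: "\<rho> = \<rho>'" if *: "\<rho> \<in> ?X" "\<rho>' \<in> ?X" "internal v" "v \<in> route_verts \<rho>" "v \<in> route_verts \<rho>'"
    "\<forall>a\<in>route_arcs \<rho>. \<kappa> a = k" "\<forall>a\<in>route_arcs \<rho>'. \<kappa> a = k" for \<rho> \<rho>' v k
  proof -
    have r: "\<rho> \<in> Routes" "\<rho>' \<in> Routes" using * by (auto simp: exceptional_routes_def)
    obtain a where a: "a \<in> route_arcs \<rho>" "a \<in> in_arcs G v" using route_enters_internal[OF r(1)] * by blast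
    obtain b where b: "b \<in> route_arcs \<rho>'" "b \<in> in_arcs G v" using route_enters_internal[OF r(2)] * by blast
    have "a = b" using a b * by (intro framing_in_unique[OF \<kappa> \<open>internal v\<close>]) auto
    then show ?thesis using exceptional_ex1[OF \<kappa>, of a] a b * by auto
  qed
  define A where "A = {\<rho> \<in> ?X. \<forall>a\<in>route_arcs \<rho>. \<kappa> a = Red}"
  define B where "B = ?X - A"
  have B: "\<forall>a\<in>route_arcs \<rho>. \<kappa> a = Blue" if "\<rho> \<in> B" for \<rho>
    using that colour.exhaust unfolding A_def B_def exceptional_routes_eq[OF \<kappa>] monochromatic_def
    by (smt (verit) DiffE mem_Collect_eq)
  have "\<rho> \<in> A \<and> \<rho>' \<in> B \<or> \<rho> \<in> B \<and> \<rho>' \<in> A" if "\<rho> \<in> ?X" "\<rho>' \<in> ?X" "\<rho> \<noteq> \<rho>'"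
    "internal v" "v \<in> route_verts \<rho>" "v \<in> route_verts \<rho>'" for \<rho> \<rho>' v
  proof (rule ccontr)
    assume "\<not> ?thesis"
    then have "\<rho> \<in> A \<and> \<rho>' \<in> A \<or> \<rho> \<in> B \<and> \<rho>' \<in> B" using that(1,2) by (auto simp: B_def)
    then have "\<exists>k. (\<forall>a\<in>route_arcs \<rho>. \<kappa> a = k) \<and> (\<forall>a\<in>route_arcs \<rho>'. \<kappa> a = k)"
      using B by (auto simp: A_def)
    then show False using * that by blast
  qed
  moreover have "?X = A \<union> B" "A \<inter> B = {}" by (auto simp: A_def B_def)
  ultimately show ?thesis unfolding bipartite_def Adj_def
    by (intro exI[of _ A] exI[of _ B]) auto
qed

text \<open>Colour each arc by the side of the bipartition that contains its route.\<close>

lemma framing_of_bipartite: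
  assumes X: "Cycles \<subseteq> X" "X \<subseteq> Routes"
    and ex1: "\<And>e. e \<in> arcs G \<Longrightarrow> \<exists>!\<rho>. \<rho> \<in> X \<and> e \<in> route_arcs \<rho>"
    and bip: "bipartite (Adj X)"
  shows "\<exists>\<kappa>. cyclic_ample_framing \<kappa> \<and> (\<forall>\<rho>\<in>X. monochromatic \<kappa> (route_arcs \<rho>))"
proof -
  obtain A B where AB: "X = A \<union> B" "A \<inter> B = {}"
    and sides: "\<forall>e\<in>arcs (Adj X). fst e \<in> A \<and> snd e \<in> B \<or> fst e \<in> B \<and> snd e \<in> A"
    using bip unfolding bipartite_def by (auto simp: Adj_def)
  \<comment> \<open>For an arc of the graph the described route is unique by \<open>ex1\<close>;
    elsewhere the colour is arbitrary.\<close>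
  define \<kappa> where "\<kappa> e = (if (THE \<rho>. \<rho> \<in> X \<and> e \<in> route_arcs \<rho>) \<in> A then Red else Blue)" for e
  have \<kappa>: "\<kappa> e = (if \<rho> \<in> A then Red else Blue)" if "\<rho> \<in> X" "e \<in> route_arcs \<rho>" for \<rho> e
  proof -
    have "e \<in> arcs G" using that X route_arcs_subset by blast
    then have "(THE \<rho>. \<rho> \<in> X \<and> e \<in> route_arcs \<rho>) = \<rho>" using ex1 that by (blast intro: the1_equality)
    then show ?thesis by (simp add: \<kappa>_def)
  qed
  have mono: "monochromatic \<kappa> (route_arcs \<rho>)" if "\<rho> \<in> X" for \<rho>
    using \<kappa>[OF that] by (auto simp: monochromatic_def)
  \<comment> \<open>Two arcs on the same side of \<open>v\<close> lie on different routes because a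
    route visits \<open>v\<close> only once. These routes are adjacent, hence on opposite sides of
    the bipartition.\<close>
  have differ: "\<kappa> a \<noteq> \<kappa> b" if ab: "a \<in> arcs G" "b \<in> arcs G" "a \<noteq> b" "internal v"
    "head G a = v \<and> head G b = v \<or> tail G a = v \<and> tail G b = v" for a b v
  proof -
    obtain \<rho> where \<rho>: "\<rho> \<in> X" "a \<in> route_arcs \<rho>" using ex1 ab(1) by blast
    obtain \<rho>' where \<rho>': "\<rho>' \<in> X" "b \<in> route_arcs \<rho>'" using ex1 ab(2) by blast
    have "\<rho> \<noteq> \<rho>'"
      using inj_on_head_tail_route[of \<rho>] X(2) \<rho> \<rho>' ab(3,5) by (auto dest: inj_onD)
    moreover have "v \<in> route_verts \<rho>" "v \<in> route_verts \<rho>'"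
      using imageI[OF \<rho>(2)] imageI[OF \<rho>'(2)] ab(5) unfolding route_verts_def by (metis UnI1 UnI2)+
    ultimately have "(\<rho>, \<rho>') \<in> arcs (Adj X)" using \<rho> \<rho>' ab(4) by (auto simp: Adj_def)
    then have "\<rho> \<in> A \<and> \<rho>' \<in> B \<or> \<rho> \<in> B \<and> \<rho>' \<in> A" using sides by fastforce
    then show ?thesis using \<kappa>[OF \<rho>] \<kappa>[OF \<rho>'] AB(2) by auto
  qed
  \<comment> \<open>With only two arcs into or out of a vertex, different colours mean that each
    colour occurs exactly once.\<close>
  have two: "\<exists>!e. e \<in> S \<and> \<kappa> e = k" if "card S = 2" "\<And>a b. a \<in> S \<Longrightarrow> b \<in> S \<Longrightarrow> a \<noteq> b \<Longrightarrow> \<kappa> a \<noteq> \<kappa> b"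
    for S k
  proof -
    obtain a b where "S = {a, b}" "a \<noteq> b" using \<open>card S = 2\<close> by (auto simp: card_2_iff)
    then have "\<kappa> a \<noteq> \<kappa> b" "S = {a, b}" using that(2) by auto
    then show ?thesis by (cases k; cases "\<kappa> a"; cases "\<kappa> b") auto
  qed
  have "cyclic_ample_framing \<kappa>" unfolding cyclic_ample_framing_def
  proof (intro conjI allI impI)
    fix v k assume v: "internal v"
    show "\<exists>!e. e \<in> in_arcs G v \<and> \<kappa> e = k"
      using full[OF v] differ v by (intro two) (auto simp: in_degree_def)
    show "\<exists>!e. e \<in> out_arcs G v \<and> \<kappa> e = k"
      using full[OF v] differ v by (intro two) (auto simp: out_degree_def)
  next
    fix c assume "minimal_cycle c"
    then have "cyc c \<in> X" using X(1) by (auto simp: Cycles_def)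
    from mono[OF this] show "\<exists>k. \<forall>e\<in>set c. \<kappa> e = k" by (simp add: monochromatic_def)
  qed
  then show ?thesis using mono by blast
qed

lemma exceptional_iff:
  assumes "X \<subseteq> Routes"
  shows "(\<exists>\<kappa>. cyclic_ample_framing \<kappa> \<and> X = exceptional_routes \<kappa>)
    \<longleftrightarrow> (Cycles \<subseteq> X \<and> X \<subseteq> Routes) \<and>
        (\<forall>e\<in>arcs G. \<exists>!\<rho>. \<rho> \<in> X \<and> e \<in> route_arcs \<rho>) \<and> bipartite (Adj X)"
proof
  assume "\<exists>\<kappa>. cyclic_ample_framing \<kappa> \<and> X = exceptional_routes \<kappa>"
  then show "(Cycles \<subseteq> X \<and> X \<subseteq> Routes) \<and>
      (\<forall>e\<in>arcs G. \<exists>!\<rho>. \<rho> \<in> X \<and> e \<in> route_arcs \<rho>) \<and> bipartite (Adj X)"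
    using assms Cycles_exceptional exceptional_ex1 bipartite_exceptional by blast
next
  assume R: "(Cycles \<subseteq> X \<and> X \<subseteq> Routes) \<and>
      (\<forall>e\<in>arcs G. \<exists>!\<rho>. \<rho> \<in> X \<and> e \<in> route_arcs \<rho>) \<and> bipartite (Adj X)"
  then obtain \<kappa> where \<kappa>: "cyclic_ample_framing \<kappa>"
    and mono: "\<And>\<rho>. \<rho> \<in> X \<Longrightarrow> monochromatic \<kappa> (route_arcs \<rho>)"
    using framing_of_bipartite[of X] by blast
  have "X \<subseteq> exceptional_routes \<kappa>"
    using assms mono unfolding exceptional_routes_eq[OF \<kappa>] by auto
  \<comment> \<open>Every exceptional route shares an arc with a route of \<open>X\<close>. That
    route is exceptional as well, so uniqueness identifies the two.\<close>
  moreover have "\<rho> \<in> X" if \<rho>: "\<rho> \<in> exceptional_routes \<kappa>" for \<rho>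
  proof -
    obtain e where e: "e \<in> arcs G" "e \<in> route_arcs \<rho>"
      using route_arcs_nonempty \<rho> by (auto simp: exceptional_routes_def)
    then obtain \<rho>' where "\<rho>' \<in> X" "e \<in> route_arcs \<rho>'" using R by blast
    then show ?thesis
      using exceptional_ex1[OF \<kappa> e(1)] e \<rho> \<open>X \<subseteq> exceptional_routes \<kappa>\<close> by blast
  qed
  ultimately show "\<exists>\<kappa>. cyclic_ample_framing \<kappa> \<and> X = exceptional_routes \<kappa>" using \<kappa> by blast
qed

end

theorem theorem6p18:
  fixes H :: "('a, 'b) pre_digraph"
    and X :: "'b route set"
  assumes "full_digraph H"
    and "X \<subseteq> wf_digraph.Routes H"
  shows "(\<exists>\<kappa>. wf_digraph.cyclic_ample_framing H \<kappa> \<and>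
              X = wf_digraph.exceptional_routes H \<kappa>)
    \<longleftrightarrow> (wf_digraph.Cycles H \<subseteq> X \<and> X \<subseteq> wf_digraph.Routes H) \<and>
        (\<forall>e\<in>arcs H. \<exists>!\<rho>. \<rho> \<in> X \<and> e \<in> route_arcs \<rho>) \<and>
        bipartite (wf_digraph.Adj H X)"
proof -
  interpret full_digraph H by (rule assms(1))
  show ?thesis using assms(2) by (rule exceptional_iff)
qed

end
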